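(* Let $(Y,G,Z)$ be random variables on a common probability space with $Y\in\{0,1\}$, $0<P(Y=1)<1$, $G\in\{0,1\}$, and $Z$ real-valued with finite second moment. Suppose $Z$ is globally calibrated, i.e. $\mathbb{E}[Y\mid Z=z]=z$ for all $z$. Then $$\delta_B(0)\,\omega_Y(0)+\delta_B(1)\,\omega_Y(1)+\sum_z \delta_C(z)\,\omega_Z(z)=\mathrm{MSE}(Z)\,\bigl(P(G=1\mid Y=1)-P(G=1\mid Y=0)\bigr),$$ where $\mathrm{MSE}(Z)=\mathbb{E}[(Y-Z)^2]$. (The sum of the first two terms on the left is $\delta_B$ and the sum over $z$ is $\delta_C$.)
   Context: $Y$ is an outcome, $G$ a binary group indicator, $Z$ a risk score. Pointwise miscalibration: $\delta_C(z)=\mathbb{E}[Y\mid Z=z,G=1]-\mathbb{E}[Y\mid Z=z,G=0]$, with weight $\omega_Z(z)=\mathrm{Var}(G\mid Z=z)\,P(Z=z)$, and $\delta_C=\sum_z\delta_C(z)\,\omega_Z(z)$. If $Z$ is not discrete, the sum is replaced by an integral and $P(Z=z)$ by the density of $Z$, i.e. $\delta_C=\int \delta_C(z)\,\mathrm{Var}(G\mid Z=z)\,dP_Z(z)$ with $P_Z$ the law of $Z$. Pointwise imbalance: $\delta_B(y)=\mathbb{E}[Z\mid Y=y,G=1]-\mathbb{E}[Z\mid Y=y,G=0]$, with weight $\omega_Y(y)=\mathrm{Var}(G\mid Y=y)\,P(Y=y)$. Conventions: statements about conditional expectations given $Z=z$ hold for almost every $z$ with respect to the law of $Z$ (so global calibration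 means $\mathbb{E}[Y\mid Z]=Z$ almost surely); a term whose weight vanishes because only one group is present (so that $\delta_C(z)$ or $\delta_B(y)$ is undefined) is taken to be $0$. *)

theory Defs
  imports "HOL-Probability.Probability"
begin

text \<open>
  The regression function \<open>x \<mapsto> E[f | X = x]\<close> is a measurable function \<open>g\<close> with
  \<open>g(X) = E[f | \<sigma>(X)]\<close> almost surely. Such a \<open>g\<close> exists and is unique almost everywhere
  with respect to the law of \<open>X\<close> (proved below); one version is chosen.
  At an atom of \<open>X\<close> the value does not depend on the choice.
\<close>

definition cond_exp_given ::
    "'a measure \<Rightarrow> 'b measure \<Rightarrow> ('a \<Rightarrow> 'b) \<Rightarrow> ('a \<Rightarrow> real) \<Rightarrow> 'b \<Rightarrow> real" where
  "cond_exp_given M N X f =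
     (SOME g. g \<in> borel_measurable N \<and>
        (AE \<omega> in M. g (X \<omega>) = real_cond_exp M (vimage_algebra (space M) X N) f \<omega>))"

lemma borel_measurable_vimage_algebra_factor:
  fixes f :: "'a \<Rightarrow> real"
  assumes X: "X \<in> \<Omega> \<rightarrow> space N" and f: "f \<in> borel_measurable (vimage_algebra \<Omega> X N)"
  obtains g where "g \<in> borel_measurable N" "\<And>\<omega>. \<omega> \<in> \<Omega> \<Longrightarrow> g (X \<omega>) = f \<omega>"
proof -
  let ?V = "vimage_algebra \<Omega> X N"
  obtain s where s: "\<And>i. simple_function ?V (s i)"
      and lim: "\<And>\<omega>. \<omega> \<in> space ?V \<Longrightarrow> (\<lambda>i. s i \<omega>) \<longlonglongrightarrow> f \<omega>"
    using borel_measurable_implies_sequence_metric[OF f, of 0] by simp metis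
  define B where "B i y = (SOME A. A \<in> sets N \<and> s i -` {y} \<inter> \<Omega> = X -` A \<inter> \<Omega>)" for i y
  have B: "B i y \<in> sets N \<and> s i -` {y} \<inter> \<Omega> = X -` B i y \<inter> \<Omega>" for i y
  proof -
    have "s i -` {y} \<inter> \<Omega> \<in> sets ?V"
      using simple_functionD(2)[OF s[of i], of "{y}"] by simp
    then have "\<exists>A. A \<in> sets N \<and> s i -` {y} \<inter> \<Omega> = X -` A \<inter> \<Omega>"
      unfolding sets_vimage_algebra2[OF X] by auto
    then show ?thesis unfolding B_def by (rule someI_ex)
  qed
  define h where "h i x = (\<Sum>y\<in>s i ` \<Omega>. y * indicator (B i y) x)" for i x
  have fin: "finite (s i ` \<Omega>)" for i
    using simple_functionD(1)[OF s[of i]] by simp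
  have h_eq: "h i (X \<omega>) = s i \<omega>" if "\<omega> \<in> \<Omega>" for i \<omega>
  proof -
    have "y * indicator (B i y) (X \<omega>) = (if y = s i \<omega> then y else 0)" for y
      using B[of i y] that by (auto simp: indicator_def)
    then have "h i (X \<omega>) = (\<Sum>y\<in>s i ` \<Omega>. if y = s i \<omega> then y else 0)"
      unfolding h_def by (intro sum.cong) auto
    also have "\<dots> = s i \<omega>"
      using sum.delta[OF fin[of i], of "s i \<omega>" "\<lambda>y. y"] that by simp
    finally show ?thesis .
  qed
  have h_meas: "h i \<in> borel_measurable N" for i
    unfolding h_def
    by (intro borel_measurable_sum borel_measurable_times borel_measurable_const
        borel_measurable_indicator B[THEN conjunct1])
  show thesis
  proof (rule that)
    show "(\<lambda>x. lim (\<lambda>i. h i x)) \<in> borel_measurable N"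
      using h_meas by (rule borel_measurable_lim_metric)
    show "lim (\<lambda>i. h i (X \<omega>)) = f \<omega>" if "\<omega> \<in> \<Omega>" for \<omega>
      proof (rule limI)
      have "(\<lambda>i. h i (X \<omega>)) = (\<lambda>i. s i \<omega>)"
        using h_eq[OF that] by (rule ext)
      then show "(\<lambda>i. h i (X \<omega>)) \<longlonglongrightarrow> f \<omega>"
        using lim[of \<omega>] that by (simp only: space_vimage_algebra)
    qed
  qed
qed

lemma cond_exp_given:
  assumes X: "X \<in> measurable M N"
  shows borel_measurable_cond_exp_given [measurable]:
      "cond_exp_given M N X f \<in> borel_measurable N"
    and AE_cond_exp_given:
      "AE \<omega> in M. cond_exp_given M N X f (X \<omega>) =
         real_cond_exp M (vimage_algebra (space M) X N) f \<omega>"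
proof -
  let ?c = "real_cond_exp M (vimage_algebra (space M) X N) f"
  have "X \<in> space M \<rightarrow> space N" using X by (rule measurable_space[THEN funcsetI])
  then obtain g where "g \<in> borel_measurable N" "\<And>\<omega>. \<omega> \<in> space M \<Longrightarrow> g (X \<omega>) = ?c \<omega>"
    by (rule borel_measurable_vimage_algebra_factor
        [OF _ borel_measurable_cond_exp[of M "vimage_algebra (space M) X N" f]]) blast
  then have "\<exists>g. g \<in> borel_measurable N \<and> (AE \<omega> in M. g (X \<omega>) = ?c \<omega>)"
    by (intro exI[of _ g] conjI AE_I2)
  from someI_ex[OF this]
  show "cond_exp_given M N X f \<in> borel_measurable N" "AE \<omega> in M. cond_exp_given M N X f (X \<omega>) = ?c \<omega>"
    by (simp_all only: cond_exp_given_def)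
qed

lemma cond_exp_given_unique:
  assumes X: "X \<in> measurable M N" and [measurable]: "g \<in> borel_measurable N"
    and g: "AE \<omega> in M. g (X \<omega>) = real_cond_exp M (vimage_algebra (space M) X N) f \<omega>"
  shows "AE x in distr M N X. g x = cond_exp_given M N X f x"
proof -
  note [measurable] = X borel_measurable_cond_exp_given[OF X]
  have "AE \<omega> in M. g (X \<omega>) = cond_exp_given M N X f (X \<omega>)"
    using g AE_cond_exp_given[OF X, of f] by eventually_elim simp
  then show ?thesis by (subst AE_distr_iff) auto
qed

text \<open>The centring term inside the square is the random variable \<open>E[f | X]\<close>.\<close>

definition cond_var_given ::
    "'a measure \<Rightarrow> 'b measure \<Rightarrow> ('a \<Rightarrow> 'b) \<Rightarrow> ('a \<Rightarrow> real) \<Rightarrow> 'b \<Rightarrow> real" where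
  "cond_var_given M N X f =
     cond_exp_given M N X (\<lambda>\<omega>. (f \<omega> - cond_exp_given M N X f (X \<omega>))\<^sup>2)"

definition globally_calibrated :: "'a measure \<Rightarrow> ('a \<Rightarrow> real) \<Rightarrow> ('a \<Rightarrow> real) \<Rightarrow> bool" where
  "globally_calibrated M Y Z \<longleftrightarrow>
     (AE \<omega> in M. real_cond_exp M (vimage_algebra (space M) Z borel) Y \<omega> = Z \<omega>)"

text \<open>
  \<open>group_gap M Y G Z z = E[Y | Z = z, G = 1] - E[Y | Z = z, G = 0]\<close>. If only one group is present
  at \<open>z\<close>, one of the two terms is an arbitrary real number, which is then multiplied by the weight
  \<open>Var(G | Z = z) = 0\<close>.
\<close>

definition group_gap ::
    "'a measure \<Rightarrow> ('a \<Rightarrow> real) \<Rightarrow> ('a \<Rightarrow> real) \<Rightarrow> ('a \<Rightarrow> real) \<Rightarrow> real \<Rightarrow> real" where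
  "group_gap M Y G Z z =
     cond_exp_given M (borel \<Otimes>\<^sub>M borel) (\<lambda>\<omega>. (Z \<omega>, G \<omega>)) Y (z, 1) -
     cond_exp_given M (borel \<Otimes>\<^sub>M borel) (\<lambda>\<omega>. (Z \<omega>, G \<omega>)) Y (z, 0)"

definition pointwise_miscalibration ::
    "'a measure \<Rightarrow> ('a \<Rightarrow> real) \<Rightarrow> ('a \<Rightarrow> real) \<Rightarrow> ('a \<Rightarrow> real) \<Rightarrow> real \<Rightarrow> real" where
  "pointwise_miscalibration M Y G Z z = group_gap M Y G Z z"

definition pointwise_imbalance ::
    "'a measure \<Rightarrow> ('a \<Rightarrow> real) \<Rightarrow> ('a \<Rightarrow> real) \<Rightarrow> ('a \<Rightarrow> real) \<Rightarrow> real \<Rightarrow> real" where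
  "pointwise_imbalance M Y G Z y = group_gap M Z G Y y"

text \<open>\<open>Z\<close> need not be discrete: the sum over \<open>z\<close> with \<open>P(Z = z)\<close> is the integral against its law.\<close>

definition miscalibration ::
    "'a measure \<Rightarrow> ('a \<Rightarrow> real) \<Rightarrow> ('a \<Rightarrow> real) \<Rightarrow> ('a \<Rightarrow> real) \<Rightarrow> real" where
  "miscalibration M Y G Z =
     (\<integral>z. pointwise_miscalibration M Y G Z z * cond_var_given M borel Z G z \<partial>distr M borel Z)"

definition imbalance_weight ::
    "'a measure \<Rightarrow> ('a \<Rightarrow> real) \<Rightarrow> ('a \<Rightarrow> real) \<Rightarrow> real \<Rightarrow> real" where
  "imbalance_weight M Y G y = cond_var_given M borel Y G y * \<P>(\<omega> in M. Y \<omega> = y)"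

definition mse :: "'a measure \<Rightarrow> ('a \<Rightarrow> real) \<Rightarrow> ('a \<Rightarrow> real) \<Rightarrow> real" where
  "mse M Y Z = (\<integral>\<omega>. (Y \<omega> - Z \<omega>)\<^sup>2 \<partial>M)"

end

theory Submission
  imports Defs
begin

text \<open>
  Integrated over a set \<open>A\<close> of values of \<open>X\<close>, the group gap of \<open>f\<close> given \<open>X\<close>, weighted by
  \<open>Var(G | X)\<close>, equals \<open>E[1\<^sub>A(X) (f - E[f | X]) G]\<close>, because pointwise it is the conditional
  covariance of \<open>f\<close> and \<open>G\<close> given \<open>X\<close>. By calibration the miscalibration is therefore
  \<open>E[G Y] - E[G Z]\<close>, and the imbalance is \<open>E[G Z] - e\<^sub>1 E[G Y] - e\<^sub>0 E[G (1 - Y)]\<close> with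
  \<open>e\<^sub>y = E[Z | Y = y]\<close>; the terms \<open>E[G Z]\<close> cancel. Calibration also gives \<open>E[Y Z] = E[Z\<^sup>2]\<close>, so that
  \<open>(1 - e\<^sub>1) P(Y = 1)\<close>, \<open>e\<^sub>0 P(Y = 0)\<close> and the mean squared error all equal \<open>P(Y = 1) - E[Z\<^sup>2]\<close>.
\<close>

section \<open>Sigma-algebras generated by a random variable\<close>

lemma subalgebra_vimage_algebra:
  assumes "X \<in> measurable M N"
  shows "subalgebra M (vimage_algebra (space M) X N)"
  using sets_image_in_sets[OF refl assms] by (simp add: subalgebra_def)

lemma measurable_comp_vimage_algebra:
  assumes X: "X \<in> measurable M N" and g: "g \<in> measurable N L"
  shows "(\<lambda>\<omega>. g (X \<omega>)) \<in> measurable (vimage_algebra (space M) X N) L"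
proof -
  have "X \<in> measurable (vimage_algebra (space M) X N) N"
    using X by (intro measurable_vimage_algebra1) (auto dest: measurable_space)
  then show ?thesis using g by (rule measurable_compose)
qed

section \<open>Conditioning on a variable together with a group\<close>

context finite_measure
begin

lemma finite_measure_subalgebra_vimage:
  assumes "X \<in> measurable M N"
  shows "finite_measure_subalgebra M (vimage_algebra (space M) X N)"
  by unfold_locales (rule subalgebra_vimage_algebra[OF assms])

text \<open>
  Condition on \<open>(X, G)\<close> first and then on \<open>X\<close>. Only the product with the indicator
  need be integrable: \<open>E[f | X = x, G = c]\<close> on its own is arbitrary where \<open>G = c\<close> has
  conditional probability \<open>0\<close>.
\<close>

lemma real_cond_exp_times_indicator_fibre:
  fixes f :: "'a \<Rightarrow> real"
  assumes X: "X \<in> measurable M N" and G: "G \<in> measurable M L"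
    and c: "{c} \<in> sets L" and f: "integrable M f"
  defines "V \<equiv> vimage_algebra (space M) X N"
  shows "AE \<omega> in M. real_cond_exp M V (\<lambda>\<omega>. f \<omega> * indicator {c} (G \<omega>)) \<omega> =
           cond_exp_given M (N \<Otimes>\<^sub>M L) (\<lambda>\<omega>. (X \<omega>, G \<omega>)) f (X \<omega>, c) *
           real_cond_exp M V (\<lambda>\<omega>. indicator {c} (G \<omega>)) \<omega>"
proof -
  define W where "W = vimage_algebra (space M) (\<lambda>\<omega>. (X \<omega>, G \<omega>)) (N \<Otimes>\<^sub>M L)"
  define a where "a = cond_exp_given M (N \<Otimes>\<^sub>M L) (\<lambda>\<omega>. (X \<omega>, G \<omega>)) f"
  define I where "I \<omega> = (indicator {c} (G \<omega>) :: real)" for \<omega>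
  have XG: "(\<lambda>\<omega>. (X \<omega>, G \<omega>)) \<in> measurable M (N \<Otimes>\<^sub>M L)"
    using X G by measurable
  interpret V: finite_measure_subalgebra M V
    unfolding V_def using X by (rule finite_measure_subalgebra_vimage)
  interpret W: finite_measure_subalgebra M W
    unfolding W_def using XG by (rule finite_measure_subalgebra_vimage)
  \<comment> \<open>As the first coordinate of the pair, \<open>X\<close> is measurable for
    \<open>W\<close>. Hence \<open>V\<close> lies inside \<open>W\<close>, as the tower property
    requires.\<close>
  have "X \<in> measurable W N"
    unfolding W_def using measurable_comp_vimage_algebra[OF XG measurable_fst] by simp
  then have WV: "subalgebra W V"
    using subalgebra_vimage_algebra[of X W N] by (simp add: V_def W_def)
  have G_W: "G \<in> measurable W L"
    unfolding W_def using measurable_comp_vimage_algebra[OF XG measurable_snd] by simp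
  have c': "c \<in> space L" using sets.sets_into_space[OF c] by simp
  have [measurable]: "f \<in> borel_measurable M" "X \<in> measurable M N" "G \<in> measurable M L" "{c} \<in> sets L"
    using f X G c by auto
  have I_W: "I \<in> borel_measurable W"
    unfolding I_def using G_W c by measurable
  have I_M [measurable]: "I \<in> borel_measurable M"
    unfolding I_def by measurable
  have [measurable]: "a \<in> borel_measurable (N \<Otimes>\<^sub>M L)"
    unfolding a_def by (rule borel_measurable_cond_exp_given[OF XG])
  have a_c: "(\<lambda>x. a (x, c)) \<in> borel_measurable N"
    using c' by measurable
  have a_V: "(\<lambda>\<omega>. a (X \<omega>, c)) \<in> borel_measurable V"
    unfolding V_def by (rule measurable_comp_vimage_algebra[OF X a_c])
  have a_M: "(\<lambda>\<omega>. a (X \<omega>, c)) \<in> borel_measurable M"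
    using V.subalg a_V by (rule measurable_from_subalg)
  have int_fI: "integrable M (\<lambda>\<omega>. f \<omega> * I \<omega>)"
    by (rule Bochner_Integration.integrable_bound[OF f]) (auto simp: I_def indicator_def)
  have "AE \<omega> in M. real_cond_exp M W (\<lambda>\<omega>. I \<omega> * f \<omega>) \<omega> = I \<omega> * real_cond_exp M W f \<omega>"
    using int_fI by (intro W.real_cond_exp_mult I_W) (simp_all add: mult.commute)
  moreover have "AE \<omega> in M. a (X \<omega>, G \<omega>) = real_cond_exp M W f \<omega>"
    unfolding a_def W_def by (rule AE_cond_exp_given[OF XG])
  ultimately have W_eq: "AE \<omega> in M. real_cond_exp M W (\<lambda>\<omega>. f \<omega> * I \<omega>) \<omega> = a (X \<omega>, c) * I \<omega>"
    by eventually_elim (auto simp: I_def indicator_def mult.commute)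
  \<comment> \<open>No bound on \<open>a (X \<omega>, c)\<close> is at hand, so integrability is
    carried over from the conditional expectation of \<open>f * I\<close> along
    \<open>W_eq\<close>.\<close>
  have int_aI: "integrable M (\<lambda>\<omega>. a (X \<omega>, c) * I \<omega>)"
    using W.real_cond_exp_int(1)[OF int_fI] a_M W_eq
    by (subst integrable_cong_AE[where g = "real_cond_exp M W (\<lambda>\<omega>. f \<omega> * I \<omega>)"]) auto
  have "AE \<omega> in M. real_cond_exp M V (real_cond_exp M W (\<lambda>\<omega>. f \<omega> * I \<omega>)) \<omega> =
          real_cond_exp M V (\<lambda>\<omega>. a (X \<omega>, c) * I \<omega>) \<omega>"
    using a_M by (intro V.real_cond_exp_cong W_eq) auto
  moreover have "AE \<omega> in M. real_cond_exp M V (real_cond_exp M W (\<lambda>\<omega>. f \<omega> * I \<omega>)) \<omega> =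
          real_cond_exp M V (\<lambda>\<omega>. f \<omega> * I \<omega>) \<omega>"
    by (rule V.real_cond_exp_nested_subalg[OF W.subalg WV int_fI])
  moreover have "AE \<omega> in M. real_cond_exp M V (\<lambda>\<omega>. a (X \<omega>, c) * I \<omega>) \<omega> =
          a (X \<omega>, c) * real_cond_exp M V I \<omega>"
    by (rule V.real_cond_exp_mult[OF a_V I_M int_aI])
  ultimately show ?thesis
    unfolding a_def[symmetric] I_def[symmetric] by eventually_elim simp
qed

text \<open>With \<open>P = E[G | X]\<close> and \<open>G\<^sup>2 = G\<close>, the square
  \<open>(G - P)\<^sup>2\<close> equals \<open>(1 - 2 * P) * G + P\<^sup>2\<close>. This is affine
  in \<open>G\<close> with coefficients known given \<open>X\<close>, so conditioning replaces
  \<open>G\<close> by \<open>P\<close>. Boundedness of \<open>P\<close> supplies the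
  integrability.\<close>

lemma AE_cond_var_given_binary:
  fixes G :: "'a \<Rightarrow> real"
  assumes X: "X \<in> measurable M N" and G [measurable]: "G \<in> borel_measurable M"
    and G01: "\<And>\<omega>. \<omega> \<in> space M \<Longrightarrow> G \<omega> \<in> {0, 1}"
  defines "V \<equiv> vimage_algebra (space M) X N"
  shows "AE \<omega> in M. cond_var_given M N X G (X \<omega>) =
           real_cond_exp M V G \<omega> * (1 - real_cond_exp M V G \<omega>)"
proof -
  interpret V: finite_measure_subalgebra M V
    unfolding V_def using X by (rule finite_measure_subalgebra_vimage)
  define P where "P = real_cond_exp M V G"
  have P_V [measurable]: "P \<in> borel_measurable V" and P_M [measurable]: "P \<in> borel_measurable M"
    unfolding P_def by auto
  have p_M: "(\<lambda>\<omega>. cond_exp_given M N X G (X \<omega>)) \<in> borel_measurable M"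
    using X borel_measurable_cond_exp_given[OF X] by (rule measurable_compose)
  have int_G: "integrable M G"
    by (rule integrable_const_bound[where B = 1]) (use G01 in fastforce)+
  have P01: "AE \<omega> in M. \<bar>P \<omega>\<bar> \<le> 1"
  proof -
    have "AE \<omega> in M. P \<omega> \<ge> 0" "AE \<omega> in M. P \<omega> \<le> 1"
      unfolding P_def using G01
      by (intro V.real_cond_exp_ge_c V.real_cond_exp_le_c int_G AE_I2; force)+
    then show ?thesis by eventually_elim simp
  qed
  have int_P2: "integrable M (\<lambda>\<omega>. P \<omega> * P \<omega>)"
    by (rule integrable_const_bound[where B = 1])
      (use P01 in \<open>simp_all add: abs_square_le_1 flip: power2_eq_square\<close>)
  have int_G2: "integrable M (\<lambda>\<omega>. (1 - 2 * P \<omega>) * G \<omega>)"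
  \<comment> \<open>The bound 3 is \<open>1 + 2 * 1\<close>, from
    \<open>\<bar>P \<omega>\<bar> \<le> 1\<close>; the factor \<open>G\<close> is at most 1.\<close>
  proof (rule integrable_const_bound[where B = 3])
    show "AE \<omega> in M. norm ((1 - 2 * P \<omega>) * G \<omega>) \<le> 3"
      using P01 AE_space by eventually_elim (use G01 in \<open>fastforce simp: abs_mult\<close>)
  qed simp
  have "AE \<omega> in M. cond_exp_given M N X G (X \<omega>) = P \<omega>"
    unfolding P_def V_def by (rule AE_cond_exp_given[OF X])
  then have "AE \<omega> in M. (G \<omega> - cond_exp_given M N X G (X \<omega>))\<^sup>2 = (1 - 2 * P \<omega>) * G \<omega> + P \<omega> * P \<omega>"
    using AE_space by eventually_elim (use G01 in \<open>force simp: power2_eq_square algebra_simps\<close>)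
  then have "AE \<omega> in M. real_cond_exp M V (\<lambda>\<omega>. (G \<omega> - cond_exp_given M N X G (X \<omega>))\<^sup>2) \<omega> =
      real_cond_exp M V (\<lambda>\<omega>. (1 - 2 * P \<omega>) * G \<omega> + P \<omega> * P \<omega>) \<omega>"
    using p_M by (intro V.real_cond_exp_cong) auto
  moreover have "AE \<omega> in M. real_cond_exp M V (\<lambda>\<omega>. (1 - 2 * P \<omega>) * G \<omega> + P \<omega> * P \<omega>) \<omega> =
      real_cond_exp M V (\<lambda>\<omega>. (1 - 2 * P \<omega>) * G \<omega>) \<omega> + real_cond_exp M V (\<lambda>\<omega>. P \<omega> * P \<omega>) \<omega>"
    by (rule V.real_cond_exp_add[OF int_G2 int_P2])
  moreover have "AE \<omega> in M. real_cond_exp M V (\<lambda>\<omega>. P \<omega> * P \<omega>) \<omega> = P \<omega> * P \<omega>"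
    by (rule V.real_cond_exp_F_meas[OF int_P2]) measurable
  moreover have "AE \<omega> in M. real_cond_exp M V (\<lambda>\<omega>. (1 - 2 * P \<omega>) * G \<omega>) \<omega> = (1 - 2 * P \<omega>) * P \<omega>"
    unfolding P_def by (rule V.real_cond_exp_mult[OF _ G int_G2[unfolded P_def]]) measurable
  moreover have "AE \<omega> in M. cond_var_given M N X G (X \<omega>) =
      real_cond_exp M V (\<lambda>\<omega>. (G \<omega> - cond_exp_given M N X G (X \<omega>))\<^sup>2) \<omega>"
    unfolding cond_var_given_def V_def by (rule AE_cond_exp_given[OF X])
  ultimately show ?thesis
    unfolding P_def[symmetric] by eventually_elim (simp add: algebra_simps)
qed

section \<open>Weighted group gaps as conditional covariances\<close>

text \<open>The right-hand side is the conditional covariance of \<open>f\<close> and \<open>G\<close> given \<open>X\<close>.\<close>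

lemma AE_group_gap_times_cond_var:
  fixes f G X :: "'a \<Rightarrow> real"
  assumes X: "X \<in> borel_measurable M" and G [measurable]: "G \<in> borel_measurable M"
    and f: "integrable M f"
    and G01: "\<And>\<omega>. \<omega> \<in> space M \<Longrightarrow> G \<omega> \<in> {0, 1}"
  defines "V \<equiv> vimage_algebra (space M) X borel"
  shows "AE \<omega> in M. group_gap M f G X (X \<omega>) * cond_var_given M borel X G (X \<omega>) =
           real_cond_exp M V (\<lambda>\<omega>. f \<omega> * G \<omega>) \<omega> - real_cond_exp M V G \<omega> * real_cond_exp M V f \<omega>"
proof -
  interpret V: finite_measure_subalgebra M V
    unfolding V_def using X by (rule finite_measure_subalgebra_vimage)
  have [measurable]: "f \<in> borel_measurable M" using f by simp
  have int_G: "integrable M G"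
    by (rule integrable_const_bound[where B = 1]) (use G01 in fastforce)+
  have int_fG: "integrable M (\<lambda>\<omega>. f \<omega> * G \<omega>)"
    by (rule Bochner_Integration.integrable_bound[OF f]) (use G01 in fastforce)+
  have cong: "AE \<omega> in M. real_cond_exp M V g \<omega> = real_cond_exp M V h \<omega>"
    if "\<And>\<omega>. \<omega> \<in> space M \<Longrightarrow> g \<omega> = h \<omega>" "g \<in> borel_measurable M" "h \<in> borel_measurable M" for g h
    using that by (intro V.real_cond_exp_cong AE_I2)
  \<comment> \<open>Since \<open>G\<close> is binary, its fibre indicators are \<open>G\<close> and
    \<open>1 - G\<close>. The fibre formula for \<open>c = 1\<close> and \<open>c = 0\<close> thus
    involves only the conditional expectations of \<open>f * G\<close>, \<open>f\<close> and
    \<open>G\<close>.\<close>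
  have ind: "indicator {1} (G \<omega>) = G \<omega>" "indicator {0} (G \<omega>) = 1 - G \<omega>" if "\<omega> \<in> space M" for \<omega>
    using G01[OF that] by auto
  have "AE \<omega> in M. real_cond_exp M V (\<lambda>\<omega>. f \<omega> * indicator {1} (G \<omega>)) \<omega> =
      real_cond_exp M V (\<lambda>\<omega>. f \<omega> * G \<omega>) \<omega>"
    by (rule cong) (simp_all add: ind)
  moreover have "AE \<omega> in M. real_cond_exp M V (\<lambda>\<omega>. indicator {1} (G \<omega>)) \<omega> = real_cond_exp M V G \<omega>"
    by (rule cong) (simp_all add: ind)
  moreover have "AE \<omega> in M. real_cond_exp M V (\<lambda>\<omega>. f \<omega> * indicator {0} (G \<omega>)) \<omega> =
      real_cond_exp M V (\<lambda>\<omega>. f \<omega> - f \<omega> * G \<omega>) \<omega>"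
    by (rule cong) (simp_all add: ind algebra_simps)
  moreover have "AE \<omega> in M. real_cond_exp M V (\<lambda>\<omega>. f \<omega> - f \<omega> * G \<omega>) \<omega> =
      real_cond_exp M V f \<omega> - real_cond_exp M V (\<lambda>\<omega>. f \<omega> * G \<omega>) \<omega>"
    by (rule V.real_cond_exp_diff[OF f int_fG])
  moreover have "AE \<omega> in M. real_cond_exp M V (\<lambda>\<omega>. indicator {0} (G \<omega>)) \<omega> =
      real_cond_exp M V (\<lambda>\<omega>. 1 - G \<omega>) \<omega>"
    by (rule cong) (simp_all add: ind)
  moreover have "AE \<omega> in M. real_cond_exp M V (\<lambda>\<omega>. 1 - G \<omega>) \<omega> =
      real_cond_exp M V (\<lambda>_. 1) \<omega> - real_cond_exp M V G \<omega>"
    by (intro V.real_cond_exp_diff int_G) simp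
  moreover have "AE \<omega> in M. real_cond_exp M V (\<lambda>_. 1) \<omega> = 1"
    by (intro V.real_cond_exp_F_meas) simp_all
  moreover note real_cond_exp_times_indicator_fibre[OF X G _ f, of 1, folded V_def, simplified]
    real_cond_exp_times_indicator_fibre[OF X G _ f, of 0, folded V_def, simplified]
  moreover have "AE \<omega> in M. cond_var_given M borel X G (X \<omega>) =
      real_cond_exp M V G \<omega> * (1 - real_cond_exp M V G \<omega>)"
    unfolding V_def using X G G01 by (rule AE_cond_var_given_binary)
  ultimately show ?thesis
  proof eventually_elim
    case (elim \<omega>)
    define p a b e k where "p = real_cond_exp M V G \<omega>"
      and "a = cond_exp_given M (borel \<Otimes>\<^sub>M borel) (\<lambda>\<omega>. (X \<omega>, G \<omega>)) f (X \<omega>, 1)"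
      and "b = cond_exp_given M (borel \<Otimes>\<^sub>M borel) (\<lambda>\<omega>. (X \<omega>, G \<omega>)) f (X \<omega>, 0)"
      and "e = real_cond_exp M V f \<omega>" and "k = real_cond_exp M V (\<lambda>\<omega>. f \<omega> * G \<omega>) \<omega>"
    have "k = a * p" "e - k = b * (1 - p)"
      using elim unfolding p_def a_def b_def e_def k_def by simp_all
    \<comment> \<open>Multiply the first equation by \<open>1 - p\<close>, the second by
      \<open>p\<close>, and subtract. No division occurs, so \<open>p = 0\<close> and
      \<open>p = 1\<close>, where \<open>a\<close> or \<open>b\<close> is arbitrary, need no
      separate case.\<close>
    then have "(a - b) * (p * (1 - p)) = k - p * e" by algebra
    then show ?case
      using elim unfolding group_gap_def p_def a_def b_def e_def k_def by simp
  qed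
qed

text \<open>Integrating the conditional covariance leaves an expectation of \<open>G\<close> against
  the residual of \<open>f\<close>. Taking \<open>A = {y}\<close> serves the imbalance at
  \<open>y\<close>, and \<open>A = UNIV\<close> the miscalibration.\<close>

lemma integral_group_gap_times_cond_var:
  fixes f G X :: "'a \<Rightarrow> real"
  assumes X [measurable]: "X \<in> borel_measurable M" and G [measurable]: "G \<in> borel_measurable M"
    and f: "integrable M f"
    and G01: "\<And>\<omega>. \<omega> \<in> space M \<Longrightarrow> G \<omega> \<in> {0, 1}" and A [measurable]: "A \<in> sets borel"
  defines "V \<equiv> vimage_algebra (space M) X borel"
  shows "(\<integral>x. indicator A x * (group_gap M f G X x * cond_var_given M borel X G x) \<partial>distr M borel X) =
           (\<integral>\<omega>. indicator A (X \<omega>) * (f \<omega> - real_cond_exp M V f \<omega>) * G \<omega> \<partial>M)"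
proof -
  interpret V: finite_measure_subalgebra M V
    unfolding V_def using X by (rule finite_measure_subalgebra_vimage)
  define I where "I \<omega> = (indicator A (X \<omega>) :: real)" for \<omega>
  let ?E = "real_cond_exp M V"
  have [measurable]: "f \<in> borel_measurable M" using f by simp
  have I_V [measurable]: "I \<in> borel_measurable V"
    unfolding I_def V_def by (rule measurable_comp_vimage_algebra[OF X]) measurable
  have [measurable]: "I \<in> borel_measurable M"
    unfolding I_def by measurable
  have int_IfG: "integrable M (\<lambda>\<omega>. I \<omega> * (f \<omega> * G \<omega>))"
    by (rule Bochner_Integration.integrable_bound[OF f]) (use G01 in \<open>fastforce simp: I_def indicator_def\<close>)+
  have int_IEG: "integrable M (\<lambda>\<omega>. I \<omega> * ?E f \<omega> * G \<omega>)"
    by (rule Bochner_Integration.integrable_bound[OF V.real_cond_exp_int(1)[OF f]])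
      (use G01 in \<open>fastforce simp: I_def indicator_def\<close>)+
  have meas: "(\<lambda>\<omega>. I \<omega> * ?E f \<omega>) \<in> borel_measurable V" by measurable
  have [measurable]: "group_gap M f G X \<in> borel_measurable borel"
    unfolding group_gap_def
    using borel_measurable_cond_exp_given[of "\<lambda>\<omega>. (X \<omega>, G \<omega>)" M "borel \<Otimes>\<^sub>M borel" f] by measurable
  have [measurable]: "cond_var_given M borel X G \<in> borel_measurable borel"
    unfolding cond_var_given_def by (rule borel_measurable_cond_exp_given[OF X])
  have "(\<integral>x. indicator A x * (group_gap M f G X x * cond_var_given M borel X G x) \<partial>distr M borel X) =
      (\<integral>\<omega>. I \<omega> * (group_gap M f G X (X \<omega>) * cond_var_given M borel X G (X \<omega>)) \<partial>M)"
    unfolding I_def by (rule integral_distr) measurable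
  also have "\<dots> = (\<integral>\<omega>. I \<omega> * ?E (\<lambda>\<omega>. f \<omega> * G \<omega>) \<omega> - I \<omega> * ?E f \<omega> * ?E G \<omega> \<partial>M)"
  proof (rule integral_cong_AE)
    have "AE \<omega> in M. group_gap M f G X (X \<omega>) * cond_var_given M borel X G (X \<omega>) =
        ?E (\<lambda>\<omega>. f \<omega> * G \<omega>) \<omega> - ?E G \<omega> * ?E f \<omega>"
      unfolding V_def using X G f G01 by (rule AE_group_gap_times_cond_var)
    then show "AE \<omega> in M. I \<omega> * (group_gap M f G X (X \<omega>) * cond_var_given M borel X G (X \<omega>)) =
        I \<omega> * ?E (\<lambda>\<omega>. f \<omega> * G \<omega>) \<omega> - I \<omega> * ?E f \<omega> * ?E G \<omega>"
      by eventually_elim (simp add: right_diff_distrib)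
  qed measurable
  also have "\<dots> = (\<integral>\<omega>. I \<omega> * ?E (\<lambda>\<omega>. f \<omega> * G \<omega>) \<omega> \<partial>M) - (\<integral>\<omega>. I \<omega> * ?E f \<omega> * ?E G \<omega> \<partial>M)"
    by (intro Bochner_Integration.integral_diff V.real_cond_exp_intg(1) int_IfG int_IEG meas) measurable
  \<comment> \<open>Both conditional expectations are removed by averaging against a factor
    measurable for \<open>V\<close>: \<open>I\<close> in the first integral,
    \<open>I * E[f | X]\<close> in the second.\<close>
  also have "\<dots> = (\<integral>\<omega>. I \<omega> * (f \<omega> * G \<omega>) \<partial>M) - (\<integral>\<omega>. I \<omega> * ?E f \<omega> * G \<omega> \<partial>M)"
    using V.real_cond_exp_intg(2)[OF int_IfG I_V] V.real_cond_exp_intg(2)[OF int_IEG meas] by simp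
  also have "\<dots> = (\<integral>\<omega>. I \<omega> * (f \<omega> - ?E f \<omega>) * G \<omega> \<partial>M)"
    using int_IfG int_IEG by (subst Bochner_Integration.integral_diff[symmetric]) (simp_all add: algebra_simps)
  finally show ?thesis unfolding I_def .
qed

text \<open>On \<open>{y}\<close> the function \<open>g\<close> is the constant \<open>g y\<close>.
  This exchanges a weight \<open>P(X = y)\<close> for an integral against the law of
  \<open>X\<close>, so sums over values of \<open>Y\<close> fit the integral formula.\<close>

lemma integral_indicator_singleton_distr:
  fixes X :: "'a \<Rightarrow> real" and g :: "real \<Rightarrow> real"
  assumes [measurable]: "X \<in> borel_measurable M"
  shows "(\<integral>x. indicator {y} x * g x \<partial>distr M borel X) = g y * measure M {\<omega> \<in> space M. X \<omega> = y}"
proof -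
  have "(\<integral>x. indicator {y} x * g x \<partial>distr M borel X) = (\<integral>x. g y * indicator {y} x \<partial>distr M borel X)"
    by (rule Bochner_Integration.integral_cong) (auto simp: indicator_def)
  also have "\<dots> = g y * measure (distr M borel X) {y}" by simp
  also have "measure (distr M borel X) {y} = measure M {\<omega> \<in> space M. X \<omega> = y}"
    by (subst measure_distr) (auto intro!: arg_cong[where f = "measure M"])
  finally show ?thesis .
qed

end

theorem proposition1:
  fixes M :: "'a measure" and Y G Z :: "'a \<Rightarrow> real"
  assumes "prob_space M"
    and "Y \<in> borel_measurable M" and "G \<in> borel_measurable M" and "Z \<in> borel_measurable M"
    and "\<And>\<omega>. \<omega> \<in> space M \<Longrightarrow> Y \<omega> \<in> {0, 1}"
    and "\<And>\<omega>. \<omega> \<in> space M \<Longrightarrow> G \<omega> \<in> {0, 1}"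
    and "0 < \<P>(\<omega> in M. Y \<omega> = 1)" and "\<P>(\<omega> in M. Y \<omega> = 1) < 1"
    and "integrable M (\<lambda>\<omega>. (Z \<omega>)\<^sup>2)"
    and "globally_calibrated M Y Z"
  shows "pointwise_imbalance M Y G Z 0 * imbalance_weight M Y G 0
       + pointwise_imbalance M Y G Z 1 * imbalance_weight M Y G 1
       + miscalibration M Y G Z
       = mse M Y Z * (\<P>(\<omega> in M. G \<omega> = 1 \<bar> Y \<omega> = 1) - \<P>(\<omega> in M. G \<omega> = 1 \<bar> Y \<omega> = 0))"
proof -
  interpret prob_space M by fact
  note [measurable] = assms(2-4)
  note Y01 = assms(5) and G01 = assms(6)
  let ?VZ = "vimage_algebra (space M) Z borel" and ?VY = "vimage_algebra (space M) Y borel"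
  interpret VZ: finite_measure_subalgebra M ?VZ
    by (rule finite_measure_subalgebra_vimage) measurable
  interpret VY: finite_measure_subalgebra M ?VY
    by (rule finite_measure_subalgebra_vimage) measurable
  have cal: "AE \<omega> in M. real_cond_exp M ?VZ Y \<omega> = Z \<omega>"
    using assms(10) unfolding globally_calibrated_def .
  have int_Z: "integrable M Z"
    using assms(4,9) by (rule square_integrable_imp_integrable)
  have int_Y: "integrable M Y" and int_G: "integrable M G" and int_GY: "integrable M (\<lambda>\<omega>. G \<omega> * Y \<omega>)"
    by ((rule integrable_const_bound[where B = 1]; use Y01 G01 in fastforce))+
  have int_GZ: "integrable M (\<lambda>\<omega>. G \<omega> * Z \<omega>)" and int_ZY: "integrable M (\<lambda>\<omega>. Z \<omega> * Y \<omega>)"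
    by (rule Bochner_Integration.integrable_bound[OF int_Z]; use Y01 G01 in fastforce)+

  \<comment> \<open>Moments of the outcome and the calibrated score\<close>
  define q where "q = \<P>(\<omega> in M. Y \<omega> = 1)"
  have EY: "expectation Y = q"
  proof -
    have "expectation Y = expectation (indicator {\<omega> \<in> space M. Y \<omega> = 1})"
      by (rule Bochner_Integration.integral_cong) (use Y01 in \<open>auto simp: indicator_def\<close>)
    then show ?thesis by (simp add: q_def)
  qed
  have prob_Y0: "\<P>(\<omega> in M. Y \<omega> = 0) = 1 - q"
  proof -
    have "{\<omega> \<in> space M. Y \<omega> = 0} = space M - {\<omega> \<in> space M. Y \<omega> = 1}"
      using Y01 by auto
    then show ?thesis by (simp add: q_def prob_compl)
  qed
  have EZ: "expectation Z = q"
    using integral_cong_AE[OF _ _ cal] VZ.real_cond_exp_int(2)[OF int_Y] EY by simp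
  \<comment> \<open>\<open>Z\<close> is measurable for the sigma-algebra it generates, so under the
    expectation \<open>Y\<close> may be replaced by \<open>E[Y | Z]\<close>, which is
    \<open>Z\<close> by calibration.\<close>
  have EZY: "expectation (\<lambda>\<omega>. Z \<omega> * Y \<omega>) = expectation (\<lambda>\<omega>. (Z \<omega>)\<^sup>2)"
  proof -
    have Z_VZ: "Z \<in> borel_measurable ?VZ"
      using measurable_comp_vimage_algebra[of Z M borel "\<lambda>x. x"] by simp
    have "expectation (\<lambda>\<omega>. Z \<omega> * Y \<omega>) = expectation (\<lambda>\<omega>. Z \<omega> * real_cond_exp M ?VZ Y \<omega>)"
      using VZ.real_cond_exp_intg(2)[OF int_ZY Z_VZ] by simp
    also have "\<dots> = expectation (\<lambda>\<omega>. (Z \<omega>)\<^sup>2)"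
      using cal by (intro integral_cong_AE) (auto simp: power2_eq_square)
    finally show ?thesis .
  qed
  define s where "s = expectation (\<lambda>\<omega>. (Z \<omega>)\<^sup>2)"
  have mse: "mse M Y Z = q - s"
  proof -
    \<comment> \<open>The leading term is linear because \<open>Y\<^sup>2 = Y\<close>.\<close>
    have "mse M Y Z = expectation (\<lambda>\<omega>. Y \<omega> - 2 * (Z \<omega> * Y \<omega>) + (Z \<omega>)\<^sup>2)"
      unfolding mse_def
      by (rule Bochner_Integration.integral_cong) (use Y01 in \<open>force simp: power2_eq_square algebra_simps\<close>)+
    also have "\<dots> = q - s"
      using int_Y int_ZY assms(9) by (simp add: EY EZY s_def)
    finally show ?thesis .
  qed

  \<comment> \<open>Imbalance on the fibres of the outcome\<close>
  define e where "e = cond_exp_given M borel Y Z"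
  have e: "AE \<omega> in M. e (Y \<omega>) = real_cond_exp M ?VY Z \<omega>"
    unfolding e_def by (rule AE_cond_exp_given) measurable
  have [measurable]: "e \<in> borel_measurable borel"
    unfolding e_def by (rule borel_measurable_cond_exp_given) measurable
  have int_ind: "integrable M (\<lambda>\<omega>. indicator {y} (Y \<omega>) * h \<omega>)" if "integrable M h" for h :: "'a \<Rightarrow> real" and y
    by (rule Bochner_Integration.integrable_bound[OF that]) (use that in \<open>auto simp: indicator_def\<close>)
  \<comment> \<open>The chosen version of \<open>E[Z | Y]\<close> is fixed only up to null sets of
    the law of \<open>Y\<close>; this identity pins down its value at each atom.\<close>
  have fibre_mean: "expectation (\<lambda>\<omega>. indicator {y} (Y \<omega>) * Z \<omega>) = e y * \<P>(\<omega> in M. Y \<omega> = y)" for y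
  proof -
    have ind_VY: "(\<lambda>\<omega>. indicator {y} (Y \<omega>) :: real) \<in> borel_measurable ?VY"
      by (rule measurable_comp_vimage_algebra) measurable
    have "expectation (\<lambda>\<omega>. indicator {y} (Y \<omega>) * Z \<omega>) =
        expectation (\<lambda>\<omega>. indicator {y} (Y \<omega>) * real_cond_exp M ?VY Z \<omega>)"
      using VY.real_cond_exp_intg(2)[OF int_ind[OF int_Z] ind_VY] by simp
    also have "\<dots> = expectation (\<lambda>\<omega>. indicator {y} (Y \<omega>) * e (Y \<omega>))"
      using e by (intro integral_cong_AE) auto
    also have "\<dots> = (\<integral>x. indicator {y} x * e x \<partial>distr M borel Y)"
      by (rule integral_distr[symmetric]) measurable
    also have "\<dots> = e y * \<P>(\<omega> in M. Y \<omega> = y)"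
      by (rule integral_indicator_singleton_distr) measurable
    finally show ?thesis .
  qed
  have imbalance: "pointwise_imbalance M Y G Z y * imbalance_weight M Y G y =
      expectation (\<lambda>\<omega>. indicator {y} (Y \<omega>) * (G \<omega> * Z \<omega>)) -
      e y * expectation (\<lambda>\<omega>. indicator {y} (Y \<omega>) * G \<omega>)" for y
  proof -
    have "pointwise_imbalance M Y G Z y * imbalance_weight M Y G y =
        (\<integral>x. indicator {y} x * (group_gap M Z G Y x * cond_var_given M borel Y G x) \<partial>distr M borel Y)"
      by (subst integral_indicator_singleton_distr)
        (simp_all add: pointwise_imbalance_def imbalance_weight_def mult.assoc)
    also have "\<dots> = expectation (\<lambda>\<omega>. indicator {y} (Y \<omega>) * (Z \<omega> - real_cond_exp M ?VY Z \<omega>) * G \<omega>)"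
      by (rule integral_group_gap_times_cond_var) (use int_Z G01 in simp_all)
    \<comment> \<open>On the event \<open>Y = y\<close> the random variable \<open>E[Z | Y]\<close>
      is almost surely the constant \<open>e y\<close>.\<close>
    also have "\<dots> = expectation (\<lambda>\<omega>. indicator {y} (Y \<omega>) * (G \<omega> * Z \<omega>) - e y * (indicator {y} (Y \<omega>) * G \<omega>))"
      using e by (intro integral_cong_AE) (auto simp: indicator_def algebra_simps)
    also have "\<dots> = expectation (\<lambda>\<omega>. indicator {y} (Y \<omega>) * (G \<omega> * Z \<omega>)) -
        e y * expectation (\<lambda>\<omega>. indicator {y} (Y \<omega>) * G \<omega>)"
      using int_ind[OF int_GZ] int_ind[OF int_G] by simp
    finally show ?thesis .
  qed
  have ind: "indicator {1} (Y \<omega>) = Y \<omega>" "indicator {0} (Y \<omega>) = 1 - Y \<omega>" if "\<omega> \<in> space M" for \<omega>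
    using Y01[OF that] by auto
  have split: "expectation (\<lambda>\<omega>. indicator {0} (Y \<omega>) * h \<omega>) + expectation (\<lambda>\<omega>. indicator {1} (Y \<omega>) * h \<omega>)
      = expectation h" if "integrable M h" for h :: "'a \<Rightarrow> real"
  proof -
    have "expectation h = expectation (\<lambda>\<omega>. indicator {0} (Y \<omega>) * h \<omega> + indicator {1} (Y \<omega>) * h \<omega>)"
      by (rule Bochner_Integration.integral_cong) (simp_all add: ind left_diff_distrib)
    then show ?thesis
      using int_ind[OF that] by simp
  qed

  \<comment> \<open>Miscalibration under global calibration\<close>
  have miscal: "miscalibration M Y G Z = expectation (\<lambda>\<omega>. G \<omega> * Y \<omega>) - expectation (\<lambda>\<omega>. G \<omega> * Z \<omega>)"
  proof -
    have "miscalibration M Y G Z =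
        (\<integral>x. indicator UNIV x * (group_gap M Y G Z x * cond_var_given M borel Z G x) \<partial>distr M borel Z)"
      by (simp add: miscalibration_def pointwise_miscalibration_def)
    also have "\<dots> = expectation (\<lambda>\<omega>. indicator UNIV (Z \<omega>) * (Y \<omega> - real_cond_exp M ?VZ Y \<omega>) * G \<omega>)"
      by (rule integral_group_gap_times_cond_var) (use int_Y G01 in simp_all)
    also have "\<dots> = expectation (\<lambda>\<omega>. G \<omega> * Y \<omega> - G \<omega> * Z \<omega>)"
      using cal by (intro integral_cong_AE) (auto simp: algebra_simps)
    also have "\<dots> = expectation (\<lambda>\<omega>. G \<omega> * Y \<omega>) - expectation (\<lambda>\<omega>. G \<omega> * Z \<omega>)"
      using int_GY int_GZ by simp
    finally show ?thesis .
  qed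

  \<comment> \<open>Combining the two contributions\<close>
  define g0 g1 where "g0 = expectation (\<lambda>\<omega>. indicator {0} (Y \<omega>) * G \<omega>)"
    and "g1 = expectation (\<lambda>\<omega>. indicator {1} (Y \<omega>) * G \<omega>)"
  have GY: "expectation (\<lambda>\<omega>. G \<omega> * Y \<omega>) = g1"
    unfolding g1_def by (intro Bochner_Integration.integral_cong) (simp_all add: ind mult.commute)
  have e1: "e 1 * q = s"
  proof -
    have "e 1 * q = expectation (\<lambda>\<omega>. indicator {1} (Y \<omega>) * Z \<omega>)"
      unfolding q_def by (rule fibre_mean[symmetric])
    also have "\<dots> = expectation (\<lambda>\<omega>. Z \<omega> * Y \<omega>)"
      by (intro Bochner_Integration.integral_cong) (simp_all add: ind mult.commute)
    finally show ?thesis by (simp add: EZY s_def)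
  qed
  \<comment> \<open>The mean \<open>q\<close> of \<open>Z\<close> splits over the two fibres of
    \<open>Y\<close> as \<open>e 0 * (1 - q) + e 1 * q\<close>, and the second part is
    \<open>s\<close>.\<close>
  have e0: "e 0 * (1 - q) = q - s"
    using split[OF int_Z] fibre_mean[of 0] fibre_mean[of 1] e1 EZ prob_Y0 by (simp add: q_def)
  have cond: "\<P>(\<omega> in M. G \<omega> = 1 \<bar> Y \<omega> = y) =
      expectation (\<lambda>\<omega>. indicator {y} (Y \<omega>) * G \<omega>) / \<P>(\<omega> in M. Y \<omega> = y)" for y
  proof -
    have "expectation (\<lambda>\<omega>. indicator {y} (Y \<omega>) * G \<omega>) =
        expectation (indicator {\<omega> \<in> space M. G \<omega> = 1 \<and> Y \<omega> = y})"
      by (rule Bochner_Integration.integral_cong) (use G01 in \<open>auto simp: indicator_def\<close>)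
    then show ?thesis by (simp add: cond_prob_def)
  qed
  have q: "q \<noteq> 0" "1 - q \<noteq> 0" using assms(7,8) by (simp_all add: q_def)
  have "pointwise_imbalance M Y G Z 0 * imbalance_weight M Y G 0
       + pointwise_imbalance M Y G Z 1 * imbalance_weight M Y G 1
       + miscalibration M Y G Z = (1 - e 1) * g1 - e 0 * g0"
    \<comment> \<open>The fibre expectations of \<open>G * Z\<close> in the two imbalance terms add
      up to the full expectation that the miscalibration subtracts.\<close>
    using split[OF int_GZ] by (simp add: imbalance miscal GY flip: g0_def g1_def) (simp add: algebra_simps)
  \<comment> \<open>The numerator \<open>q - s\<close> is the mean squared error in both fibres. The
    denominators \<open>q\<close> and \<open>1 - q\<close> turn \<open>g1\<close> and
    \<open>g0\<close> into the conditional probabilities of \<open>G = 1\<close>.\<close>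
  also have "1 - e 1 = (q - s) / q" using e1 q by (simp add: field_simps)
  also have "e 0 = (q - s) / (1 - q)" using e0 q by (simp add: field_simps)
  also have "(q - s) / q * g1 - (q - s) / (1 - q) * g0 = (q - s) * (g1 / q - g0 / (1 - q))"
    by (simp add: algebra_simps)
  finally show ?thesis
    unfolding mse cond prob_Y0 g0_def g1_def q_def .
qed

end
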